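(* Let $n$ be a positive odd integer, and let $A_1,\dots,A_n$ be finite subsets of a field $F$ with $|A_1|=\cdots=|A_n|\ge 2$. Suppose that $p(F)>\sum_{i=1}^n|A_i|-2n+1$. Then $$|L(A_1,\dots,A_n)|\ge \sum_{i=1}^n|A_i|-2n+2.$$
   Context: For finite subsets $A_1,\dots,A_n$ of a field $F$, $L(A_1,\dots,A_n)=\{a_1+\cdots+a_n:\ a_i\in A_i\ (1\le i\le n),\ a_i\ne a_{i+1}\text{ for all }1\le i<n\}$. $p(F)$ denotes the characteristic of $F$ if it is a prime, and $p(F)=+\infty$ if $F$ has characteristic $0$. *)

theory Defs
  imports "HOL-Computational_Algebra.Computational_Algebra" "HOL-Library.Extended_Nat"
begin

text \<open>
  The finite sequence \<open>A\<^sub>1, \<dots>, A\<^sub>n\<close> is the restriction of a function \<open>A\<close> on the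
  naturals to \<open>{1..n}\<close>; values outside that range are irrelevant.
\<close>

definition L :: "nat \<Rightarrow> (nat \<Rightarrow> 'a::field set) \<Rightarrow> 'a set" where
  "L n A = {\<Sum>i=1..n. a i | a.
     (\<forall>i\<in>{1..n}. a i \<in> A i) \<and> (\<forall>i\<in>{1..<n}. a i \<noteq> a (i + 1))}"

text \<open>
  The library's \<open>CHAR('a)\<close> is 0 in characteristic zero, where the convention here is
  \<open>\<infinity>\<close>. The field is passed through its type.
\<close>

definition char_inf :: "'a::field itself \<Rightarrow> enat" where
  "char_inf _ = (if CHAR('a) = 0 then \<infinity> else enat CHAR('a))"

end

(* The proof is the polynomial method with an explicit functional. For |B| = t + 1, the divided
   difference of f over B is the coefficient of x^t in the interpolation polynomial: it kills x^j
   for j < t and sends x^t to 1. Composing the divided differences over A_1, ..., A_n, applied to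
   f(x_1 + ... + x_n) times the product of the x_i - x_(i+1), gives a functional that only sees the
   values of f on L, vanishes on polynomials f of degree less than M = nt - n + 1, and sends y^M to
   the coefficient of (x_1 ... x_n)^t in (x_1 + ... + x_n)^M times that product. A two-state
   transfer matrix, whose square is t times the identity, evaluates this coefficient as
   M! t^((n-1)/2) / t!^n, which is nonzero since the characteristic exceeds M. If |L| were at most M,
   a monic f of degree M vanishing on L would give a contradiction. *)

theory Submission
  imports Defs
begin

section \<open>Divided differences as linear functionals\<close>

definition divided_difference :: "'a::field set \<Rightarrow> ('a \<Rightarrow> 'a) \<Rightarrow> 'a" where
  "divided_difference B f = (\<Sum>a\<in>B. f a / (\<Prod>b\<in>B - {a}. a - b))"

lemma divided_difference_cmult:
  "divided_difference B (\<lambda>a. c * f a) = c * divided_difference B f"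
  by (simp add: divided_difference_def sum_distrib_left)

lemma divided_difference_diff:
  "divided_difference B (\<lambda>a. f a - g a) = divided_difference B f - divided_difference B g"
  by (simp add: divided_difference_def diff_divide_distrib sum_subtractf)

lemma divided_difference_sum:
  "divided_difference B (\<lambda>a. \<Sum>l\<in>S. f l a) = (\<Sum>l\<in>S. divided_difference B (f l))"
  unfolding divided_difference_def sum_divide_distrib by (rule sum.swap)

text \<open>Lagrange interpolation of \<open>x ^ j\<close> at the \<open>t + 1\<close> nodes in
  \<open>B\<close> reproduces \<open>x ^ j\<close>, since both polynomials have degree at most
  \<open>t\<close>. The divided difference is the coefficient of \<open>x ^ t\<close> in the
  interpolant.\<close>

lemma divided_difference_power:
  fixes B :: "'a::field set"
  assumes "finite B" "card B = Suc t" "j \<le> t"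
  shows "divided_difference B (\<lambda>a. a ^ j) = (if j = t then 1 else 0)"
proof -
  define q where "q a = (\<Prod>b\<in>B - {a}. [:- b, 1:])" for a
  define w where "w a = (\<Prod>b\<in>B - {a}. a - b)" for a
  define p where "p = (\<Sum>a\<in>B. smult (a ^ j / w a) (q a))"
  have w: "w a \<noteq> 0" for a
    using assms(1) by (auto simp: w_def)
  have deg: "degree (q a) = t" if "a \<in> B" for a
    using that assms by (simp add: q_def degree_prod_eq_sum_degree)
  have lead: "coeff (q a) t = 1" if "a \<in> B" for a
  proof -
    have "lead_coeff (q a) = 1"
      unfolding q_def by (simp add: lead_coeff_prod)
    then show ?thesis using deg[OF that] by simp
  qed
  have val: "poly p x = x ^ j" if "x \<in> B" for x
  proof -
    have "poly p x = (\<Sum>a\<in>B. a ^ j / w a * poly (q a) x)"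
      by (simp add: p_def poly_sum)
    also have "\<dots> = (\<Sum>a\<in>B. if a = x then x ^ j else 0)"
    proof (rule sum.cong)
      fix a assume "a \<in> B"
      show "a ^ j / w a * poly (q a) x = (if a = x then x ^ j else 0)"
      proof (cases "a = x")
        case True
        then have "poly (q a) x = w a" by (simp add: q_def w_def poly_prod)
        with True w[of x] show ?thesis by simp
      next
        case False
        then have "poly (q a) x = 0"
          using that assms(1) by (auto simp: q_def poly_prod)
        with False show ?thesis by simp
      qed
    qed simp
    finally show ?thesis using that assms(1) by simp
  qed
  have "degree p \<le> t"
    unfolding p_def by (intro degree_sum_le assms(1) order.trans[OF degree_smult_le]) (simp add: deg)
  moreover have "degree (monom (1::'a) j) \<le> t"
    using assms(3) by (simp add: degree_monom_eq)
  ultimately have "p = monom 1 j"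
    using val assms by (intro poly_eqI_degree[of B]) (auto simp: poly_monom)
  moreover have "coeff p t = divided_difference B (\<lambda>a. a ^ j)"
    by (simp add: p_def coeff_sum lead divided_difference_def w_def)
  ultimately show ?thesis by simp
qed

section \<open>The iterated functional on admissible sums\<close>

text \<open>
  The arguments of \<open>f\<close> are the sum of all variables and the last variable; \<open>chain A i\<close>
  involves the \<open>i + 1\<close> sets \<open>A 1, \<dots>, A (i + 1)\<close>.
\<close>

primrec chain :: "(nat \<Rightarrow> 'a::field set) \<Rightarrow> nat \<Rightarrow> ('a \<Rightarrow> 'a \<Rightarrow> 'a) \<Rightarrow> 'a" where
  "chain A 0 f = divided_difference (A 1) (\<lambda>a. f a a)"
| "chain A (Suc i) f =
     chain A i (\<lambda>s a. divided_difference (A (Suc (Suc i))) (\<lambda>b. (a - b) * f (s + b) b))"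

lemma chain_cmult: "chain A i (\<lambda>s a. c * f s a) = c * chain A i f"
proof (induction i arbitrary: f)
  case 0
  show ?case by (simp add: divided_difference_cmult)
next
  case (Suc i)
  show ?case
    by (simp add: mult.left_commute[of _ c] divided_difference_cmult Suc)
qed

lemma chain_diff: "chain A i (\<lambda>s a. f s a - g s a) = chain A i f - chain A i g"
proof (induction i arbitrary: f g)
  case 0
  show ?case by (simp add: divided_difference_diff)
next
  case (Suc i)
  show ?case
    by (simp add: right_diff_distrib divided_difference_diff Suc)
qed

lemma chain_sum: "chain A i (\<lambda>s a. \<Sum>l\<in>S. f l s a) = (\<Sum>l\<in>S. chain A i (f l))"
proof (induction i arbitrary: f)
  case 0
  show ?case by (simp add: divided_difference_sum)
next
  case (Suc i)
  show ?case
    by (simp add: sum_distrib_left divided_difference_sum Suc)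
qed

text \<open>The factor \<open>a - b\<close> kills every tuple with two equal neighbours, so only
  values of \<open>f\<close> at admissible tuples enter.\<close>

lemma chain_eq_0:
  assumes "\<And>a. (\<forall>k\<in>{1..Suc i}. a k \<in> A k) \<Longrightarrow> (\<forall>k\<in>{1..<Suc i}. a k \<noteq> a (k + 1)) \<Longrightarrow>
                 f (\<Sum>k=1..Suc i. a k) (a (Suc i)) = 0"
  shows "chain A i f = 0"
  using assms
proof (induction i arbitrary: f)
  case 0
  have "f x x = 0" if "x \<in> A 1" for x
    using 0[of "\<lambda>_. x"] that by simp
  then show ?case by (simp add: divided_difference_def)
next
  case (Suc i)
  show ?case unfolding chain.simps
  proof (rule Suc.IH)
    fix a assume a: "\<forall>k\<in>{1..Suc i}. a k \<in> A k" "\<forall>k\<in>{1..<Suc i}. a k \<noteq> a (k + 1)"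
    have "(a (Suc i) - b) * f (sum a {1..Suc i} + b) b = 0" if b: "b \<in> A (Suc (Suc i))" for b
    proof (cases "b = a (Suc i)")
      case False
      define a' where "a' = a(Suc (Suc i) := b)"
      have "(\<Sum>k=1..Suc i. a' k) = (\<Sum>k=1..Suc i. a k)"
        by (rule sum.cong) (auto simp: a'_def)
      moreover have "f (\<Sum>k=1..Suc (Suc i). a' k) (a' (Suc (Suc i))) = 0"
        using a b False
        by (intro Suc.prems) (auto simp: a'_def le_Suc_eq less_Suc_eq)
      ultimately show ?thesis by (simp add: a'_def)
    qed simp
    then show "divided_difference (A (Suc (Suc i)))
        (\<lambda>b. (a (Suc i) - b) * f (sum a {1..Suc i} + b) b) = 0"
      by (simp only: divided_difference_def div_0 sum.neutral_const cong: sum.cong)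
  qed
qed

section \<open>Moments of the functional\<close>

definition moment :: "(nat \<Rightarrow> 'a::field set) \<Rightarrow> nat \<Rightarrow> nat \<Rightarrow> nat \<Rightarrow> 'a" where
  "moment A i j c = chain A i (\<lambda>s a. s ^ j * a ^ c)"

lemma moment_0: "moment A 0 j c = divided_difference (A 1) (\<lambda>a. a ^ (j + c))"
  by (simp add: moment_def power_add)

text \<open>Expanding \<open>(s + b) ^ j\<close> binomially separates the new variable
  \<open>b\<close> from the earlier ones. As \<open>a - b\<close> is linear in \<open>a\<close>,
  only the exponents 0 and 1 of the previous variable arise.\<close>

lemma moment_Suc:
  "moment A (Suc i) j c = (\<Sum>l\<le>j. of_nat (j choose l) *
     (moment A i l 1 * divided_difference (A (Suc (Suc i))) (\<lambda>b. b ^ (j - l + c)) -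
      moment A i l 0 * divided_difference (A (Suc (Suc i))) (\<lambda>b. b ^ (j - l + c + 1))))"
proof -
  let ?B = "A (Suc (Suc i))"
  let ?d = "\<lambda>k. divided_difference ?B (\<lambda>b. b ^ k)"
  have "divided_difference ?B (\<lambda>b. (a - b) * ((s + b) ^ j * b ^ c)) =
      (\<Sum>l\<le>j. of_nat (j choose l) *
        (?d (j - l + c) * (s ^ l * a ^ 1) - ?d (j - l + c + 1) * (s ^ l * a ^ 0)))" for s a
  proof -
    have "(a - b) * ((s + b) ^ j * b ^ c) =
        (\<Sum>l\<le>j. of_nat (j choose l) * s ^ l * a * b ^ (j - l + c) -
               of_nat (j choose l) * s ^ l * b ^ (j - l + c + 1))" for b
      unfolding binomial_ring sum_distrib_left sum_distrib_right power_add
      by (rule sum.cong[OF refl]) (simp add: left_diff_distrib mult_ac)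
    then have "divided_difference ?B (\<lambda>b. (a - b) * ((s + b) ^ j * b ^ c)) =
        (\<Sum>l\<le>j. of_nat (j choose l) * s ^ l * a * ?d (j - l + c) -
               of_nat (j choose l) * s ^ l * ?d (j - l + c + 1))"
      by (simp only: divided_difference_sum divided_difference_diff divided_difference_cmult)
    then show ?thesis by (simp add: algebra_simps)
  qed
  then show ?thesis
    by (simp only: moment_def chain.simps chain_sum chain_diff chain_cmult) (simp add: mult.commute)
qed

text \<open>A degree count: with the \<open>i\<close> linear factors the total degree is
  \<open>j + c + i\<close>, and each of the \<open>i + 1\<close> variables needs degree at least
  \<open>t\<close> to survive. In the induction, either the earlier moment has too low a degree or
  the power of \<open>b\<close> is below \<open>t\<close>.\<close>

lemma moment_eq_0:
  assumes "\<forall>k\<in>{1..Suc i}. finite (A k) \<and> card (A k) = Suc t"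
    and "j + c + i < Suc i * t"
  shows "moment A i j c = 0"
  using assms
proof (induction i arbitrary: j c)
  case 0
  then show ?case by (simp add: moment_0 divided_difference_power[where t = t])
next
  case (Suc i)
  have B: "finite (A (Suc (Suc i)))" "card (A (Suc (Suc i))) = Suc t"
    using Suc.prems(1) by auto
  have IH: "moment A i l e = 0" if "l + e + i < Suc i * t" for l e
    using Suc that by auto
  have "moment A i l 1 * divided_difference (A (Suc (Suc i))) (\<lambda>b. b ^ (j - l + c)) = 0"
    if "l \<le> j" for l
  proof (cases "l + 1 + i < Suc i * t")
    case False
    then have "j - l + c < t" using Suc.prems(2) that by simp
    then show ?thesis using divided_difference_power[OF B, of "j - l + c"] by simp
  qed (simp add: IH)
  moreover have
    "moment A i l 0 * divided_difference (A (Suc (Suc i))) (\<lambda>b. b ^ (j - l + c + 1)) = 0"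
    if "l \<le> j" for l
  proof (cases "l + 0 + i < Suc i * t")
    case False
    then have "j - l + c + 1 < t" using Suc.prems(2) that by simp
    then show ?thesis using divided_difference_power[OF B, of "j - l + c + 1"] by simp
  next
    case True
    then show ?thesis using IH[of l 0] by simp
  qed
  ultimately show ?case
    unfolding moment_Suc by (intro sum.neutral ballI) (simp only: atMost_iff diff_zero mult_zero_right)
qed

text \<open>In the critical degree nothing is left over, so the new variable must have exponent
  exactly \<open>t\<close>. This leaves one binomial term for each summand of
  \<open>a - b\<close>.\<close>

lemma moment_Suc_top:
  assumes A: "\<forall>k\<in>{1..Suc (Suc i)}. finite (A k) \<and> card (A k) = Suc t"
    and "t \<ge> 1" "c \<le> 1" and j: "j + c + Suc i = Suc (Suc i) * t"
    and l: "l + 1 + i = Suc i * t"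
  shows "moment A (Suc i) j c =
    of_nat (j choose l) * moment A i l 1 - of_nat (j choose Suc l) * moment A i (Suc l) 0"
proof -
  let ?d = "\<lambda>k. divided_difference (A (Suc (Suc i))) (\<lambda>b. b ^ k)"
  have B: "finite (A (Suc (Suc i)))" "card (A (Suc (Suc i))) = Suc t"
    using A by auto
  have IH: "moment A i l e = 0" if "l + e + i < Suc i * t" for l e
    using A that by (intro moment_eq_0) auto
  have jl: "j + c = l + t" using j l by simp
  have 1: "moment A i m 1 * ?d (j - m + c) = (if m = l then moment A i l 1 else 0)" if "m \<le> j" for m
  proof (cases m l rule: linorder_cases)
    case less
    then show ?thesis using l IH[of m 1] by simp
  next
    case equal
    then have "j - m + c = t" using jl that by simp
    then show ?thesis using equal divided_difference_power[OF B, of t] by simp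
  next
    case greater
    then have "j - m + c < t" using jl that by simp
    then show ?thesis using greater divided_difference_power[OF B, of "j - m + c"] by simp
  qed
  have 2: "moment A i m 0 * ?d (j - m + c + 1) =
      (if m = Suc l then moment A i (Suc l) 0 else 0)" if "m \<le> j" for m
  proof (cases m "Suc l" rule: linorder_cases)
    case less
    then show ?thesis using l IH[of m 0] by simp
  next
    case equal
    then have "j - m + c + 1 = t" using jl that by simp
    then show ?thesis using equal divided_difference_power[OF B, of t] by simp
  next
    case greater
    then have "j - m + c + 1 < t" using jl that by simp
    then show ?thesis using greater divided_difference_power[OF B, of "j - m + c + 1"] by simp
  qed
  have "moment A (Suc i) j c = (\<Sum>m\<le>j. of_nat (j choose m) *
      ((if m = l then moment A i l 1 else 0) - (if m = Suc l then moment A i (Suc l) 0 else 0)))"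
    unfolding moment_Suc by (intro sum.cong refl) (simp only: 1 2 atMost_iff)
  also have "\<dots> = (\<Sum>m\<le>j. (if m = l then of_nat (j choose l) * moment A i l 1 else 0)) -
      (\<Sum>m\<le>j. (if m = Suc l then of_nat (j choose Suc l) * moment A i (Suc l) 0 else 0))"
    unfolding sum_subtractf[symmetric] by (intro sum.cong) auto
  also have "\<dots> = of_nat (j choose l) * moment A i l 1 -
      of_nat (j choose Suc l) * moment A i (Suc l) 0"
    \<comment> \<open>For \<open>t = c = 1\<close> the index \<open>Suc l\<close> lies outside the
      range of summation, but then its binomial coefficient is 0.\<close>
    by (simp add: binomial_eq_0 not_le)
  finally show ?thesis .
qed

section \<open>The transfer matrix in the critical degree\<close>

text \<open>Since \<open>j - l = t - c\<close>, the quotient of \<open>t!\<close> by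
  \<open>(j - l)!\<close> is a falling factorial of length \<open>c\<close>. These falling
  factorials become the matrix entries.\<close>

lemma fact_mult_binomial:
  assumes "j + c = l + t" "c \<le> t"
  shows "fact t * (j choose l) * fact l = fact j * (\<Prod>k<c. t - k)"
proof -
  have "fact l * fact (t - c) * (j choose l) = (fact j :: nat)"
  proof -
    have "l \<le> j" "t - c = j - l" using assms by auto
    then show ?thesis using binomial_fact_lemma[of l j] by simp
  qed
  moreover have "fact t = fact (t - c) * (\<Prod>k<c. t - k)"
    using assms(2)
  proof (induction c)
    case (Suc c)
    then have "fact (t - c) = (t - c) * fact (t - Suc c)"
      by (metis Suc_diff_Suc Suc_le_lessD fact_Suc of_nat_id)
    then show ?case using Suc by (simp add: algebra_simps)
  qed simp
  ultimately show ?thesis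
    by (metis mult.assoc mult.commute)
qed

text \<open>The two states \<open>x\<close> and \<open>y\<close> of the transfer matrix belong to the exponents \<open>c = 0\<close> and \<open>c = 1\<close>.\<close>

definition top_moments :: "(nat \<Rightarrow> 'a::field set) \<Rightarrow> nat \<Rightarrow> nat \<Rightarrow> 'a \<Rightarrow> 'a \<Rightarrow> bool" where
  "top_moments A t i x y \<longleftrightarrow> (\<forall>j.
     (j + i = Suc i * t \<longrightarrow> of_nat (fact t) ^ Suc i * moment A i j 0 = of_nat (fact j) * x) \<and>
     (j + 1 + i = Suc i * t \<longrightarrow> of_nat (fact t) ^ Suc i * moment A i j 1 = of_nat (fact j) * y))"

text \<open>\<open>moment_Suc_top\<close> after multiplication by powers of \<open>t!\<close>.
  Factorials are multiplied out rather than divided by, so the recursion holds in every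
  characteristic.\<close>

lemma top_moments_Suc:
  fixes A :: "nat \<Rightarrow> 'a::field set"
  assumes A: "\<forall>k\<in>{1..Suc (Suc i)}. finite (A k) \<and> card (A k) = Suc t" and t: "t \<ge> 1"
    and top: "top_moments A t i x y"
  shows "top_moments A t (Suc i) (y - of_nat t * x) (of_nat t * y - of_nat (t * (t - 1)) * x)"
proof -
  define l where "l = Suc i * t - Suc i"
  have "Suc i * 1 \<le> Suc i * t" using t by (intro mult_le_mono) auto
  then have l: "l + 1 + i = Suc i * t" by (simp add: l_def)
  have top1: "of_nat (fact t) ^ Suc i * moment A i l 1 = of_nat (fact l) * y"
    using top l by (simp add: top_moments_def)
  have top0: "of_nat (fact t) ^ Suc i * moment A i (Suc l) 0 = of_nat (fact (Suc l)) * x"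
    using top l unfolding top_moments_def by (metis add.commute plus_1_eq_Suc add.assoc)
  have step: "of_nat (fact t) ^ Suc (Suc i) * moment A (Suc i) j c =
      of_nat (fact t * (j choose l) * fact l) * y
      - of_nat (fact t * (j choose Suc l) * fact (Suc l)) * x"
    if "c \<le> 1" "j + c + Suc i = Suc (Suc i) * t" for j c
  proof -
    have "of_nat (fact t) ^ Suc (Suc i) * moment A (Suc i) j c =
        of_nat (fact t * (j choose l)) * (of_nat (fact t) ^ Suc i * moment A i l 1)
        - of_nat (fact t * (j choose Suc l)) * (of_nat (fact t) ^ Suc i * moment A i (Suc l) 0)"
      unfolding moment_Suc_top[OF A t that l]
      by (simp only: power_Suc[of _ "Suc i"] of_nat_mult) (simp only: algebra_simps)
    then show ?thesis
      unfolding top0 top1 by (simp only: of_nat_mult) (simp only: algebra_simps)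
  qed
  show ?thesis unfolding top_moments_def
  proof (intro allI conjI impI)
    fix j assume j: "j + Suc i = Suc (Suc i) * t"
    have "j = l + t" using j l by simp
    then have "fact t * (j choose l) * fact l = fact j"
      "fact t * (j choose Suc l) * fact (Suc l) = fact j * t"
      using fact_mult_binomial[of j 0 l t] fact_mult_binomial[of j 1 "Suc l" t] t by auto
    then show "of_nat (fact t) ^ Suc (Suc i) * moment A (Suc i) j 0 = of_nat (fact j) * (y - of_nat t * x)"
      using step[of 0 j] j by (simp only: of_nat_mult) (simp add: algebra_simps)
  next
    fix j assume j: "j + 1 + Suc i = Suc (Suc i) * t"
    have jl: "j + 1 = l + t" using j l by simp
    then have 1: "fact t * (j choose l) * fact l = fact j * t"
      using fact_mult_binomial[of j 1 l t] t by simp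
    have 2: "fact t * (j choose Suc l) * fact (Suc l) = fact j * (t * (t - 1))"
    \<comment> \<open>The falling factorial of length 2 requires \<open>t >= 2\<close>. For
      \<open>t = 1\<close> one has \<open>j = l\<close>, so the binomial coefficient vanishes
      together with \<open>t - 1\<close>.\<close>
    proof (cases "t = 1")
      case False
      have "(\<Prod>k<2. t - k) = t * (t - 1)" by (simp add: numeral_2_eq_2)
      with False show ?thesis
        using fact_mult_binomial[of j 2 "Suc l" t] t jl by simp
    qed (use jl in simp)
    show "of_nat (fact t) ^ Suc (Suc i) * moment A (Suc i) j 1 =
        of_nat (fact j) * (of_nat t * y - of_nat (t * (t - 1)) * x)"
      using step[of 1 j] j
      unfolding 1 2 by (simp only: of_nat_mult) (simp add: algebra_simps)
  qed
qed

text \<open>The initial vector is \<open>(1, t)\<close>, because \<open>t! = t * (t - 1)!\<close>. A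
  first step sends \<open>(t ^ m, t ^ (m + 1))\<close> to \<open>(0, t ^ (m + 1))\<close>, a second
  one to \<open>t\<close> times the original. The vanishing first entry halfway is why the argument
  takes \<open>n\<close> odd.\<close>

lemma top_moments_even:
  fixes A :: "nat \<Rightarrow> 'a::field set"
  assumes "\<forall>k\<in>{1..Suc (2 * m)}. finite (A k) \<and> card (A k) = Suc t" and t: "t \<ge> 1"
  shows "top_moments A t (2 * m) (of_nat t ^ m) (of_nat t ^ Suc m)"
  using assms(1)
proof (induction m)
  case 0
  then have "finite (A 1)" "card (A 1) = Suc t" by auto
  from divided_difference_power[OF this, of t]
  have d: "divided_difference (A 1) (\<lambda>a. a ^ t) = 1" by simp
  have "of_nat (fact (j + 1)) = of_nat (j + 1) * (of_nat (fact j) :: 'a)" for j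
    by (simp add: algebra_simps)
  with d show ?case by (auto simp: top_moments_def moment_0 mult.commute)
next
  case (Suc m)
  have "top_moments A t (2 * m) (of_nat t ^ m) (of_nat t ^ Suc m)"
    using Suc by auto
  then have "top_moments A t (Suc (2 * m)) (of_nat t ^ Suc m - of_nat t * of_nat t ^ m)
      (of_nat t * of_nat t ^ Suc m - of_nat (t * (t - 1)) * of_nat t ^ m)"
    using Suc.prems t by (intro top_moments_Suc) auto
  also have "of_nat t ^ Suc m - of_nat t * of_nat t ^ m = (0::'a)" by simp
  also have "of_nat t * of_nat t ^ Suc m - of_nat (t * (t - 1)) * of_nat t ^ m =
      (of_nat t ^ Suc m :: 'a)"
    using t by (simp add: of_nat_diff algebra_simps)
  finally have "top_moments A t (Suc (Suc (2 * m))) (of_nat t ^ Suc m - of_nat t * 0)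
      (of_nat t * of_nat t ^ Suc m - of_nat (t * (t - 1)) * 0)"
    using Suc.prems t by (intro top_moments_Suc) auto
  then show ?case by simp
qed

section \<open>Nonvanishing in the field and the lower bound\<close>

lemma of_nat_neq_0_if_char_inf:
  assumes "char_inf TYPE('a::field) > enat m" "0 < k" "k \<le> m"
  shows "of_nat k \<noteq> (0::'a)"
  using assms by (auto simp: char_inf_def of_nat_eq_0_iff_char_dvd split: if_splits dest!: dvd_imp_le)

lemma fact_neq_0_if_char_inf:
  assumes "char_inf TYPE('a::field) > enat m"
  shows "of_nat (fact m) \<noteq> (0::'a)"
  using of_nat_neq_0_if_char_inf[OF assms] by (auto simp: fact_prod)

lemma finite_L:
  assumes "\<forall>i\<in>{1..n}. finite (A i)"
  shows "finite (L n A)"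
proof (rule finite_subset)
  show "L n A \<subseteq> (\<lambda>a. \<Sum>i=1..n. a i) ` (PiE {1..n} A)"
  proof
    fix s assume "s \<in> L n A"
    then obtain a where a: "s = (\<Sum>i=1..n. a i)" "\<forall>i\<in>{1..n}. a i \<in> A i"
      by (auto simp: L_def)
    then show "s \<in> (\<lambda>a. \<Sum>i=1..n. a i) ` (PiE {1..n} A)"
      by (intro image_eqI[of _ _ "restrict a {1..n}"]) auto
  qed
  show "finite ((\<lambda>a. \<Sum>i=1..n. a i) ` (PiE {1..n} A))"
    using assms by (intro finite_imageI finite_PiE) auto
qed

text \<open>All coefficients below the leading one meet moments of subcritical degree, which
  vanish.\<close>

lemma chain_poly_monic:
  assumes "\<forall>k\<in>{1..Suc i}. finite (A k) \<and> card (A k) = Suc t"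
    and "degree q + i = Suc i * t" "lead_coeff q = 1"
  shows "chain A i (\<lambda>s a. poly q s) = moment A i (degree q) 0"
proof -
  have "chain A i (\<lambda>s a. poly q s) = (\<Sum>j\<le>degree q. coeff q j * moment A i j 0)"
    by (simp add: poly_altdef chain_sum chain_cmult moment_def)
  also have "\<dots> = (\<Sum>j\<le>degree q. if j = degree q then moment A i j 0 else 0)"
  proof (rule sum.cong[OF refl])
    fix j assume j: "j \<in> {..degree q}"
    show "coeff q j * moment A i j 0 = (if j = degree q then moment A i j 0 else 0)"
    proof (cases "j = degree q")
      case False
      then have "moment A i j 0 = 0" using assms(2) j by (intro moment_eq_0[OF assms(1)]) simp
      with False show ?thesis by simp
    qed (use assms(3) in simp)
  qed
  finally show ?thesis by simp
qed

theorem theorem1p3: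
  fixes n :: nat and A :: "nat \<Rightarrow> 'a::field set"
  assumes "n > 0" and "odd n"
    and "\<forall>i\<in>{1..n}. finite (A i)"
    and "\<forall>i\<in>{1..n}. \<forall>j\<in>{1..n}. card (A i) = card (A j)"
    and "\<forall>i\<in>{1..n}. card (A i) \<ge> 2"
    and "char_inf TYPE('a) > enat ((\<Sum>i=1..n. card (A i)) - 2 * n + 1)"
  shows "int (card (L n A)) \<ge> (\<Sum>i=1..n. int (card (A i))) - 2 * int n + 2"
proof -
  obtain m where m: "n = Suc (2 * m)" using assms(2) by (auto elim: oddE)
  define t where "t = card (A 1) - 1"
  have "1 \<in> {1..n}" using assms(1) by simp
  then have "card (A 1) \<ge> 2" and card1: "\<And>k. k \<in> {1..n} \<Longrightarrow> card (A k) = card (A 1)"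
    using assms(4,5) by blast+
  then have t: "t \<ge> 1" and "card (A 1) = Suc t"
    by (simp_all add: t_def)
  with card1 have card: "card (A k) = Suc t" if "k \<in> {1..n}" for k
    using that by metis
  have A: "\<forall>k\<in>{1..Suc (2 * m)}. finite (A k) \<and> card (A k) = Suc t"
    using assms(3) card m by auto
  \<comment> \<open>The critical degree: \<open>n * t\<close> less one for each of the
    \<open>n - 1 = 2 * m\<close> linear factors. It equals the number that the characteristic is
    assumed to exceed.\<close>
  define M where "M = n * t - 2 * m"
  have "n * 1 \<le> n * t" using t by (intro mult_le_mono) auto
  then have M: "M + 2 * m = n * t" using m by (simp add: M_def)
  have sum: "(\<Sum>i=1..n. card (A i)) = n * Suc t"
    using card by simp
  \<comment> \<open>This places \<open>t\<close> below the characteristic, so the factor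
    \<open>t ^ m\<close> is nonzero in the field.\<close>
  have "M \<ge> t"
  proof -
    have "2 * m * 1 \<le> 2 * m * t" using t by (intro mult_le_mono) auto
    moreover have "n * t = 2 * m * t + t" using m by simp
    ultimately show ?thesis using M by linarith
  qed
  have char: "char_inf TYPE('a) > enat M"
  proof -
    have "n * Suc t - 2 * n + 1 = M"
      using M m \<open>M \<ge> t\<close> t by simp
    then show ?thesis using assms(6) sum by simp
  qed
  have t0: "of_nat t \<noteq> (0::'a)"
    using of_nat_neq_0_if_char_inf[OF char, of t] t \<open>M \<ge> t\<close> by simp
  have fin: "finite (L n A)" using assms(3) by (rule finite_L)
  have "\<not> card (L n A) \<le> M"
  proof
    assume le: "card (L n A) \<le> M"
    \<comment> \<open>The product vanishes on \<open>L n A\<close>; the monomial pads its degree to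
      exactly \<open>M\<close> and keeps it monic.\<close>
    define q where "q = monom 1 (M - card (L n A)) * (\<Prod>s\<in>L n A. [:- s, 1:])"
    have "degree (\<Prod>s\<in>L n A. [:- s, 1:]) = card (L n A)"
      by (simp add: degree_prod_eq_sum_degree)
    then have deg: "degree q = M"
      unfolding q_def using le fin by (subst degree_mult_eq) (auto simp: degree_monom_eq)
    have "lead_coeff (\<Prod>s\<in>L n A. [:- s, 1:]) = 1"
      by (simp add: lead_coeff_prod)
    then have lead: "lead_coeff q = 1"
      unfolding q_def lead_coeff_mult by (simp add: degree_monom_eq)
    have "chain A (2 * m) (\<lambda>s a. poly q s) = 0"
    proof (rule chain_eq_0)
      fix a assume "\<forall>k\<in>{1..Suc (2 * m)}. a k \<in> A k"
        "\<forall>k\<in>{1..<Suc (2 * m)}. a k \<noteq> a (k + 1)"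
      then have "(\<Sum>k=1..Suc (2 * m). a k) \<in> L n A"
        unfolding L_def m by blast
      then show "poly q (\<Sum>k=1..Suc (2 * m). a k) = 0"
        using fin by (auto simp: q_def poly_prod simp del: sum.cl_ivl_Suc)
    qed
    then have "moment A (2 * m) M 0 = 0"
      using chain_poly_monic[OF A, of q] deg lead M m by simp
    moreover have "of_nat (fact t) ^ Suc (2 * m) * moment A (2 * m) M 0 =
        of_nat (fact M) * of_nat t ^ m"
      using top_moments_even[OF A t] M m by (simp add: top_moments_def)
    ultimately have "of_nat (fact M) * of_nat t ^ m = (0::'a)" by simp
    then show False using t0 fact_neq_0_if_char_inf[OF char] by simp
  qed
  \<comment> \<open>The claimed bound is \<open>M + 1\<close>; it remains to rewrite it over the
    integers.\<close>
  moreover have "(\<Sum>i=1..n. int (card (A i))) = int n * int t + int n"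
    using card by (simp add: algebra_simps)
  moreover have "int n * int t = int M + 2 * int m"
    using M by (metis of_nat_add of_nat_mult of_nat_numeral)
  ultimately show ?thesis using m by simp
qed

end
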